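(* Let $n\ge1$. For $u=x_{F_1}^{a_1}\cdots x_{F_\ell}^{a_\ell}\in\widetilde{FY}(\mathsf{B}_n)$ (with $F_0=\emptyset$) define $\widetilde\phi(u)=(\alpha_1\cdots\alpha_n,f)$ as follows. If $a_1=1$, then $$\alpha_i=\begin{cases} j-1&\text{if } i\in F_j\setminus F_{j-1}\\ \infty&\text{if } i\in[n]\setminus F_\ell\end{cases}\quad(i\in[n]),\qquad f(j)=a_{j+1}\ \text{ for } j\in[\ell-1];$$ if $a_1\ge2$, then $$\alpha_i=\begin{cases} j&\text{if } i\in F_j\setminus F_{j-1}\\ \infty&\text{if } i\in[n]\setminus F_\ell\end{cases}\quad(i\in[n]),\qquad f(1)=a_1-1\ \text{ and }\ f(j)=a_j\ \text{ for } 2\le j\le\ell;$$ and $\widetilde\phi(1)=\infty\cdots\infty$ for the empty monomial ($\ell=0$). Then $\widetilde\phi:\widetilde{FY}(\mathsf{B}_n)\to\widetilde{\mathtt{Code}}_n=\bigcup_{j=-1}^{n-1}\widetilde{\mathtt{Code}}_{n,j}$ is a bijection that satisfies $\deg(u)=\mathrm{ind}(\widetilde\phi(u))+1$ and respects the $\mathfrak{S}_n$-actions on both sets, i.e. $\widetilde\phi(\sigma\cdot u)=\sigma\cdot\widetilde\phi(u)$ for all $\sigma\in\mathfrak{S}_n$.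
   Context: Write $[n]=\{1,\dots,n\}$. $\widetilde{FY}(\mathsf{B}_n)$ is the set of formal monomials $x_{F_1}^{a_1}\cdots x_{F_\ell}^{a_\ell}$ with $\ell\ge0$, $\emptyset\subsetneq F_1\subsetneq\cdots\subsetneq F_\ell\subseteq[n]$, $1\le a_1\le|F_1|$, and $1\le a_i\le|F_i|-|F_{i-1}|-1$ for $i\ge2$ ($\ell=0$ gives the monomial $1$). The degree is $\deg(u)=a_1+\cdots+a_\ell$. $\mathfrak{S}_n$ acts by $\sigma\cdot x_{F_1}^{a_1}\cdots x_{F_\ell}^{a_\ell}=x_{\sigma(F_1)}^{a_1}\cdots x_{\sigma(F_\ell)}^{a_\ell}$. An extended code of length $n$ is a pair $(\alpha,f)$ where $\alpha=\alpha_1\cdots\alpha_n$ is a sequence over $\{0,1,2,\dots\}\cup\{\infty\}$ such that, with $m(\alpha)$ the maximum finite number appearing in $\alpha$ (taken as $0$ if there is none), each $k\in\{1,\dots,m(\alpha)\}$ occurs at least twice in $\alpha$; and $f$ records a mark: for each such $k$ exactly one occurrence of $k$ other than the first is marked, and $f(k)$ is the number of occurrences of $k$ to the left of the marked one (so $1\le f(k)\le(\text{number of occurrences of }k)-1$). The letters $0$ and $\infty$ may occur any number of times. The index is $\mathrm{ind}(\alpha,f)=-1$ if $\alpha=\infty\cdots\infty$, and $\mathrm{ind}(\alpha,f)=\sum_{k=1}^{m(\alpha)}f(k)$ otherwise. $\widetilde{\mathtt{Code}}_{n,j}$ is the set of extended codes of length $n$ and index $j$. $\mathfrak{S}_n$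 acts by $\sigma\cdot(\alpha_1\cdots\alpha_n,f)=(\alpha_{\sigma^{-1}(1)}\cdots\alpha_{\sigma^{-1}(n)},f)$. *)

theory Defs
  imports "HOL-Library.Extended_Nat" "HOL-Library.FuncSet" "HOL-Combinatorics.Permutations"
begin

section \<open>Monomials\<close>

text \<open>
  The formal monomial \<open>x\<^bsub>F\<^sub>1\<^esub>^a\<^sub>1 \<cdots> x\<^bsub>F\<^sub>\<ell>\<^esub>^a\<^sub>\<ell>\<close> is encoded as the list \<open>[(F\<^sub>1, a\<^sub>1), \<dots>, (F\<^sub>\<ell>, a\<^sub>\<ell>)]\<close>.
  Since the \<open>F\<^sub>i\<close> strictly increase and the exponents are positive, distinct lists are distinct
  monomials.
\<close>
type_synonym monomial = "(nat set \<times> nat) list"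

text \<open>The accessors are 1-based, with \<open>F\<^sub>0 = \<emptyset>\<close>.\<close>
definition flat :: "monomial \<Rightarrow> nat \<Rightarrow> nat set" where
  "flat u j = (if j = 0 then {} else fst (u ! (j - 1)))"

definition expo :: "monomial \<Rightarrow> nat \<Rightarrow> nat" where
  "expo u j = snd (u ! (j - 1))"

text \<open>
  The chain condition at \<open>i = 1\<close> says that \<open>F\<^sub>1\<close> is nonempty.  No truncation occurs in the last
  bound, as \<open>F\<^sub>i\<^sub>-\<^sub>1\<close> is a proper subset of the finite set \<open>F\<^sub>i\<close>.
\<close>
definition FY_tilde :: "nat \<Rightarrow> monomial set" where
  "FY_tilde n = {u.
     (\<forall>i\<in>{1..length u}. flat u (i - 1) \<subset> flat u i \<and> flat u i \<subseteq> {1..n}) \<and>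
     (u \<noteq> [] \<longrightarrow> 1 \<le> expo u 1 \<and> expo u 1 \<le> card (flat u 1)) \<and>
     (\<forall>i\<in>{2..length u}. 1 \<le> expo u i \<and>
        expo u i \<le> card (flat u i) - card (flat u (i - 1)) - 1)}"

definition deg :: "monomial \<Rightarrow> nat" where
  "deg u = (\<Sum>i=1..length u. expo u i)"

definition act_monomial :: "(nat \<Rightarrow> nat) \<Rightarrow> monomial \<Rightarrow> monomial" where
  "act_monomial \<sigma> u = map (\<lambda>(F, a). (\<sigma> ` F, a)) u"


section \<open>Extended codes\<close>

text \<open>
  A sequence \<open>\<alpha>\<^sub>1 \<cdots> \<alpha>\<^sub>n\<close> is a function that is extensional on \<open>{1..n}\<close>, and \<open>f\<close> is a function
  that is extensional on \<open>{1..m(\<alpha>)}\<close>, so that equality of pairs is equality of codes.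
\<close>
type_synonym code = "(nat \<Rightarrow> enat) \<times> (nat \<Rightarrow> nat)"

definition max_letter :: "nat \<Rightarrow> (nat \<Rightarrow> enat) \<Rightarrow> nat" where
  "max_letter n \<alpha> = Max (insert 0 {k. enat k \<in> \<alpha> ` {1..n}})"

text \<open>Position \<open>p\<close> carries an occurrence of \<open>k\<close> other than the first one.\<close>
definition markable :: "nat \<Rightarrow> (nat \<Rightarrow> enat) \<Rightarrow> nat \<Rightarrow> nat \<Rightarrow> bool" where
  "markable n \<alpha> k p \<longleftrightarrow> p \<in> {1..n} \<and> \<alpha> p = enat k \<and> (\<exists>i\<in>{1..<p}. \<alpha> i = enat k)"

definition ext_code :: "nat \<Rightarrow> code set" where
  "ext_code n = {(\<alpha>, f).
     \<alpha> \<in> {1..n} \<rightarrow>\<^sub>E UNIV \<and>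
     (\<forall>k\<in>{1..max_letter n \<alpha>}. card {i\<in>{1..n}. \<alpha> i = enat k} \<ge> 2) \<and>
     f \<in> extensional {1..max_letter n \<alpha>} \<and>
     (\<forall>k\<in>{1..max_letter n \<alpha>}.
        \<exists>p. markable n \<alpha> k p \<and> f k = card {i\<in>{1..<p}. \<alpha> i = enat k})}"

definition ind :: "nat \<Rightarrow> code \<Rightarrow> int" where
  "ind n = (\<lambda>(\<alpha>, f).
     if \<forall>i\<in>{1..n}. \<alpha> i = \<infinity> then -1 else int (\<Sum>k=1..max_letter n \<alpha>. f k))"

definition Code_tilde_index :: "nat \<Rightarrow> int \<Rightarrow> code set" where
  "Code_tilde_index n j = {c \<in> ext_code n. ind n c = j}"

definition Code_tilde :: "nat \<Rightarrow> code set" where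
  "Code_tilde n = (\<Union>j\<in>{-1..int n - 1}. Code_tilde_index n j)"

definition act_code :: "nat \<Rightarrow> (nat \<Rightarrow> nat) \<Rightarrow> code \<Rightarrow> code" where
  "act_code n \<sigma> = (\<lambda>(\<alpha>, f). (\<lambda>i\<in>{1..n}. \<alpha> (inv \<sigma> i), f))"


section \<open>The map\<close>

text \<open>The index \<open>j\<close> with \<open>i \<in> F\<^sub>j - F\<^sub>j\<^sub>-\<^sub>1\<close>; on \<open>FY_tilde n\<close> it exists, uniquely, iff \<open>i \<in> F\<^sub>\<ell>\<close>.\<close>
definition block :: "monomial \<Rightarrow> nat \<Rightarrow> nat" where
  "block u i = (THE j. j \<in> {1..length u} \<and> i \<in> flat u j - flat u (j - 1))"

text \<open>
  On \<open>FY_tilde n\<close> the last branch is the case \<open>a\<^sub>1 \<ge> 2\<close>.  For the empty monomial \<open>f\<close> is the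
  function with empty domain.
\<close>
definition phi_tilde :: "nat \<Rightarrow> monomial \<Rightarrow> code" where
  "phi_tilde n u =
     (if u = [] then (\<lambda>i\<in>{1..n}. \<infinity>, \<lambda>_. undefined)
      else if expo u 1 = 1 then
        (\<lambda>i\<in>{1..n}. if i \<in> flat u (length u) then enat (block u i - 1) else \<infinity>,
         \<lambda>j\<in>{1..length u - 1}. expo u (j + 1))
      else
        (\<lambda>i\<in>{1..n}. if i \<in> flat u (length u) then enat (block u i) else \<infinity>,
         \<lambda>j\<in>{1..length u}. if j = 1 then expo u 1 - 1 else expo u j))"

end

theory Submission
  imports Defs
begin

text \<open>
  The exponent \<open>a\<^sub>1\<close> only decides whether the letters of the code start at \<open>0\<close> or at \<open>1\<close>.  With
  \<open>e = 1\<close> in the first case and \<open>e = 0\<close> in the second, the positions of the letter \<open>k\<close> form the set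
  \<open>F\<^sub>k\<^sub>+\<^sub>e - F\<^sub>k\<^sub>+\<^sub>e\<^sub>-\<^sub>1\<close>, and conversely \<open>F\<^sub>j\<close> consists of the positions of the letters less than
  \<open>j + 1 - e\<close>, where \<open>e\<close> is read off the code as the presence of the letter \<open>0\<close>.  A mark on the
  letter \<open>k\<close> is just a number between \<open>1\<close> and the number of occurrences of \<open>k\<close> minus \<open>1\<close>, which is
  the range allowed for the exponents.
\<close>

section \<open>Codes\<close>

text \<open>The map sends a member of \<open>A\<close> to its rank. It is strictly increasing, hence
  injective, with values below \<open>card A\<close>, so by counting every rank is attained.\<close>

lemma image_card_less_eq_lessThan:
  fixes A :: "'a::linorder set"
  assumes "finite A"
  shows "(\<lambda>p. card {i \<in> A. i < p}) ` A = {..<card A}"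
proof (rule card_subset_eq)
  have strict: "card {i \<in> A. i < p} < card {i \<in> A. i < q}" if "p \<in> A" "p < q" for p q
    using that assms by (intro psubset_card_mono) auto
  have "inj_on (\<lambda>p. card {i \<in> A. i < p}) A"
    by (rule linorder_inj_onI') (use strict in force)
  then show "card ((\<lambda>p. card {i \<in> A. i < p}) ` A) = card {..<card A}"
    by (simp add: card_image)
  show "(\<lambda>p. card {i \<in> A. i < p}) ` A \<subseteq> {..<card A}"
    using assms by (auto intro!: psubset_card_mono)
qed simp

abbreviation occ :: "nat \<Rightarrow> (nat \<Rightarrow> enat) \<Rightarrow> nat \<Rightarrow> nat set" where
  "occ n \<alpha> k \<equiv> {i\<in>{1..n}. \<alpha> i = enat k}"

text \<open>The number of occurrences of \<open>k\<close> left of an occurrence \<open>p\<close> is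
  the rank of \<open>p\<close> in \<open>occ n \<alpha> k\<close>, and \<open>p\<close> is not the
  first one iff this rank is positive. So every value from 1 to
  \<open>card (occ n \<alpha> k) - 1\<close> comes from a mark.\<close>

lemma mark_exists_iff:
  "(\<exists>p. markable n \<alpha> k p \<and> r = card {i\<in>{1..<p}. \<alpha> i = enat k}) \<longleftrightarrow> 1 \<le> r \<and> r < card (occ n \<alpha> k)"
  (is "?L \<longleftrightarrow> ?R")
proof -
  have "markable n \<alpha> k p \<and> r = card {i\<in>{1..<p}. \<alpha> i = enat k} \<longleftrightarrow>
      p \<in> occ n \<alpha> k \<and> 1 \<le> r \<and> r = card {i \<in> occ n \<alpha> k. i < p}" for p
  proof (cases "p \<in> occ n \<alpha> k")
    case True
    then have "{i \<in> occ n \<alpha> k. i < p} = {i\<in>{1..<p}. \<alpha> i = enat k}" by auto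
    moreover have "1 \<le> card {i\<in>{1..<p}. \<alpha> i = enat k} \<longleftrightarrow> (\<exists>i\<in>{1..<p}. \<alpha> i = enat k)"
      by (auto simp: Suc_le_eq card_gt_0_iff)
    ultimately show ?thesis
      using True unfolding markable_def by force
  qed (auto simp: markable_def)
  then have "?L \<longleftrightarrow> 1 \<le> r \<and> r \<in> (\<lambda>p. card {i \<in> occ n \<alpha> k. i < p}) ` occ n \<alpha> k"
    by blast
  also have "\<dots> \<longleftrightarrow> ?R"
    by (subst image_card_less_eq_lessThan) auto
  finally show ?thesis .
qed

text \<open>With marks turned into ranks, the bounds on \<open>f k\<close> also yield two
  occurrences of \<open>k\<close>. Codes are handled through these bounds from here on.\<close>

lemma ext_code_iff:
  "(\<alpha>, f) \<in> ext_code n \<longleftrightarrow>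
     \<alpha> \<in> extensional {1..n} \<and> f \<in> extensional {1..max_letter n \<alpha>} \<and>
     (\<forall>k\<in>{1..max_letter n \<alpha>}. 1 \<le> f k \<and> f k < card (occ n \<alpha> k))"
proof -
  have "card (occ n \<alpha> k) \<ge> 2"
    if "\<forall>k\<in>{1..max_letter n \<alpha>}. 1 \<le> f k \<and> f k < card (occ n \<alpha> k)" "k \<in> {1..max_letter n \<alpha>}" for k
    using bspec[OF that] by linarith
  then show ?thesis
    unfolding ext_code_def mark_exists_iff PiE_def Pi_UNIV by blast
qed

section \<open>Largest letter and range of the index\<close>

lemma finite_letters: "finite {k. enat k \<in> \<alpha> ` {1..n::nat}}"
  using finite_vimageI[of "\<alpha> ` {1..n}" enat] by (simp add: vimage_def inj_on_def)

lemma le_max_letter: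
  assumes "\<alpha> i = enat k" "i \<in> {1..n}"
  shows "k \<le> max_letter n \<alpha>"
proof -
  have "enat k \<in> \<alpha> ` {1..n}" using assms by (metis imageI)
  then show ?thesis
    unfolding max_letter_def by (intro Max_ge finite.insertI finite_letters insertI2 CollectI)
qed

text \<open>Each \<open>f k\<close> is less than the number of occurrences of \<open>k\<close>, and
  distinct letters have disjoint positions in \<open>{1..n}\<close>, so the sum is less than
  \<open>n\<close>. Without positive letters the sum is 0, and \<open>n \<ge> 1\<close>
  applies.\<close>

lemma ind_bounds:
  assumes "(\<alpha>, f) \<in> ext_code n" "n \<ge> 1"
  shows "ind n (\<alpha>, f) \<in> {-1..int n - 1}"
proof -
  let ?m = "max_letter n \<alpha>"
  have "(\<Sum>k=1..?m. f k) < n"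
  proof (cases "?m = 0")
    case False
    have "(\<Sum>k=1..?m. f k) < (\<Sum>k=1..?m. card (occ n \<alpha> k))"
      using assms False by (intro sum_strict_mono) (auto simp: ext_code_iff)
    also have "\<dots> = card (\<Union>k\<in>{1..?m}. occ n \<alpha> k)"
      by (rule card_UN_disjoint[symmetric]) auto
    also have "\<dots> \<le> card {1..n}"
      by (rule card_mono) auto
    finally show ?thesis by simp
  qed (use assms in auto)
  then have "int (\<Sum>k=1..?m. f k) \<in> {-1..int n - 1}" by (simp del: of_nat_sum)
  then show ?thesis
    unfolding ind_def by simp
qed

lemma Code_tilde_eq_ext_code: "n \<ge> 1 \<Longrightarrow> Code_tilde n = ext_code n"
  unfolding Code_tilde_def Code_tilde_index_def using ind_bounds by auto

section \<open>From monomials to codes\<close>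

lemma FY_strict:
  assumes "u \<in> FY_tilde n" "j \<in> {1..length u}"
  shows "flat u (j - 1) \<subset> flat u j"
  using assms unfolding FY_tilde_def by blast

lemma FY_chain:
  assumes "u \<in> FY_tilde n" "j \<le> k" "k \<le> length u"
  shows "flat u j \<subseteq> flat u k"
  using assms(2,3)
proof (induction k rule: dec_induct)
  case (step k)
  have "flat u (Suc k - 1) \<subset> flat u (Suc k)"
    using step.prems by (intro FY_strict[OF assms(1)]) simp
  then show ?case using step by auto
qed simp

lemma FY_flat_subset:
  assumes "u \<in> FY_tilde n" "k \<le> length u"
  shows "flat u k \<subseteq> {1..n}"
proof (cases "k = 0")
  case False
  then show ?thesis using assms unfolding FY_tilde_def by auto
qed (simp add: flat_def)

text \<open>The chain is increasing, so the differences \<open>flat u j - flat u (j - 1)\<close> are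
  pairwise disjoint and the \<open>THE\<close> in \<open>block\<close> has only one
  candidate.\<close>

lemma block_eqI:
  assumes "u \<in> FY_tilde n" "j \<in> {1..length u}" "i \<in> flat u j - flat u (j - 1)"
  shows "block u i = j"
  unfolding block_def
proof (rule the_equality)
  fix k assume k: "k \<in> {1..length u} \<and> i \<in> flat u k - flat u (k - 1)"
  have "k - 1 \<le> length u" "j - 1 \<le> length u" using k assms by auto
  have "\<not> j \<le> k - 1" using \<open>k - 1 \<le> length u\<close> FY_chain[OF assms(1), of j "k - 1"] k assms by auto
  moreover have "\<not> k \<le> j - 1" using \<open>j - 1 \<le> length u\<close> FY_chain[OF assms(1), of k "j - 1"] k assms by auto
  ultimately show "k = j" using k assms by auto
qed (use assms in auto)

lemma ex_first_flat:
  assumes "i \<in> flat u l"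
  shows "\<exists>j\<in>{1..l}. i \<in> flat u j - flat u (j - 1)"
proof -
  let ?j = "LEAST j. i \<in> flat u j"
  have "i \<in> flat u ?j" using assms by (rule LeastI)
  moreover have "?j \<le> l" using assms by (rule Least_le)
  moreover have "?j \<noteq> 0" using \<open>i \<in> flat u ?j\<close> by (metis empty_iff flat_def)
  moreover have "i \<notin> flat u (?j - 1)" using \<open>?j \<noteq> 0\<close> by (intro not_less_Least) simp
  ultimately show ?thesis by (intro bexI[of _ ?j]) auto
qed

section \<open>Letters of the image code\<close>

definition shift :: "monomial \<Rightarrow> nat" where
  "shift u = (if u \<noteq> [] \<and> expo u 1 = 1 then 1 else 0)"

text \<open>All branches of the definition become one formula, with \<open>shift u\<close> as the
  number e of the overview. The empty monomial has shift 0 and fits as well: its last flat is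
  \<open>flat [] 0 = {}\<close>, and the second component has empty domain.\<close>

lemma phi_tilde_eq:
  "phi_tilde n u =
     (\<lambda>i\<in>{1..n}. if i \<in> flat u (length u) then enat (block u i - shift u) else \<infinity>,
      \<lambda>j\<in>{1..length u - shift u}.
        if j = 1 \<and> shift u = 0 then expo u 1 - 1 else expo u (j + shift u))"
  by (auto simp: phi_tilde_def shift_def flat_def fun_eq_iff)

lemma phi_tilde_letter_iff:
  assumes "u \<in> FY_tilde n" "i \<in> {1..n}"
  shows "fst (phi_tilde n u) i = enat k \<longleftrightarrow>
    k + shift u \<in> {1..length u} \<and> i \<in> flat u (k + shift u) - flat u (k + shift u - 1)"
proof (cases "i \<in> flat u (length u)")
  case True
  then obtain j where j: "j \<in> {1..length u}" "i \<in> flat u j - flat u (j - 1)"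
    using ex_first_flat by blast
  have "block u i = j" using block_eqI[OF assms(1) j] .
  \<comment> \<open>Together with \<open>j \<ge> 1\<close> this makes the truncated subtraction
    \<open>j - shift u\<close> exact.\<close>
  moreover have "shift u \<le> 1" by (simp add: shift_def)
  ultimately have "fst (phi_tilde n u) i = enat k \<longleftrightarrow> j = k + shift u"
    using True assms(2) j by (auto simp: phi_tilde_eq)
  then show ?thesis
    using j block_eqI[OF assms(1)] \<open>block u i = j\<close> by metis
next
  case False
  then show ?thesis
    using FY_chain[OF assms(1), of "k + shift u" "length u"] assms(2) by (auto simp: phi_tilde_eq)
qed

lemma occ_phi_tilde:
  assumes "u \<in> FY_tilde n" "k + shift u \<in> {1..length u}"
  shows "occ n (fst (phi_tilde n u)) k = flat u (k + shift u) - flat u (k + shift u - 1)"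
  using assms FY_flat_subset[OF assms(1), of "k + shift u"]
  by (auto simp: phi_tilde_letter_iff)

text \<open>Strict inclusions make every block nonempty, so no letter between the smallest and the
  largest is skipped.\<close>

lemma letters_phi_tilde:
  assumes "u \<in> FY_tilde n"
  shows "enat k \<in> fst (phi_tilde n u) ` {1..n} \<longleftrightarrow> k + shift u \<in> {1..length u}"
proof -
  have "enat k \<in> fst (phi_tilde n u) ` {1..n} \<longleftrightarrow> occ n (fst (phi_tilde n u)) k \<noteq> {}"
    by force
  also have "\<dots> \<longleftrightarrow> k + shift u \<in> {1..length u}"
  proof (cases "k + shift u \<in> {1..length u}")
    case True
    then have "flat u (k + shift u - 1) \<subset> flat u (k + shift u)"
      by (rule FY_strict[OF assms])
    then show ?thesis unfolding occ_phi_tilde[OF assms True] using True by auto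
  qed (use phi_tilde_letter_iff[OF assms] in auto)
  finally show ?thesis .
qed

lemma max_letter_phi_tilde:
  assumes "u \<in> FY_tilde n"
  shows "max_letter n (fst (phi_tilde n u)) = length u - shift u"
proof -
  have "{k. enat k \<in> fst (phi_tilde n u) ` {1..n}} = {k. k + shift u \<in> {1..length u}}"
    by (simp only: letters_phi_tilde[OF assms])
  moreover have "finite {k. k + shift u \<in> {1..length u}}"
    by (rule finite_subset[of _ "{..length u}"]) auto
  moreover have "shift u \<le> length u" by (cases u) (auto simp: shift_def)
  ultimately show ?thesis
    unfolding max_letter_def by (intro Max_eqI) auto
qed

lemma card_occ_phi_tilde:
  assumes "u \<in> FY_tilde n" "k + shift u \<in> {1..length u}"
  shows "card (occ n (fst (phi_tilde n u)) k) =
    card (flat u (k + shift u)) - card (flat u (k + shift u - 1))"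
proof -
  have "flat u (k + shift u - 1) \<subseteq> flat u (k + shift u)"
    using assms by (intro FY_chain) auto
  moreover have "finite (flat u (k + shift u - 1))"
    using assms(2) by (intro finite_subset[OF FY_flat_subset[OF assms(1)]]) auto
  ultimately show ?thesis
    unfolding occ_phi_tilde[OF assms] by (rule card_Diff_subset[rotated])
qed

section \<open>Membership and degree of the image\<close>

lemma phi_tilde_in_ext_code:
  assumes u: "u \<in> FY_tilde n"
  shows "phi_tilde n u \<in> ext_code n"
proof -
  let ?\<alpha> = "fst (phi_tilde n u)" and ?f = "snd (phi_tilde n u)"
  have "1 \<le> ?f k \<and> ?f k < card (occ n ?\<alpha> k)" if k: "k \<in> {1..length u - shift u}" for k
  proof -
    have k': "k + shift u \<in> {1..length u}" using k by auto
    note c = card_occ_phi_tilde[OF u k']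
    show ?thesis
    \<comment> \<open>Only the first exponent may equal the size of its block. If it is at least 2,
      lowering it by 1 brings it into the range of a mark; if it is 1, the block carries the letter
      0, which has no mark. All other exponents already lie in that range.\<close>
    proof (cases "k = 1 \<and> shift u = 0")
      case True
      then have "u \<noteq> []" using k by auto
      then have "2 \<le> expo u 1" "expo u 1 \<le> card (flat u 1)"
        using True u unfolding FY_tilde_def shift_def by (auto split: if_splits)
      moreover have "card (occ n ?\<alpha> k) = card (flat u 1)"
        using c True by (simp add: flat_def)
      moreover have "?f k = expo u 1 - 1" using True k by (simp add: phi_tilde_eq)
      ultimately show ?thesis by auto
    next
      case False
      then have "k + shift u \<in> {2..length u}" using k by auto
      then have "1 \<le> expo u (k + shift u)"
        "expo u (k + shift u) \<le> card (flat u (k + shift u)) - card (flat u (k + shift u - 1)) - 1"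
        using u unfolding FY_tilde_def by blast+
      moreover have "?f k = expo u (k + shift u)" using False k by (auto simp: phi_tilde_eq)
      ultimately show ?thesis unfolding c by auto
    qed
  qed
  moreover have "?\<alpha> \<in> extensional {1..n}" "?f \<in> extensional {1..length u - shift u}"
    by (auto simp: phi_tilde_eq)
  ultimately have "(?\<alpha>, ?f) \<in> ext_code n"
    unfolding ext_code_iff max_letter_phi_tilde[OF u] by blast
  then show ?thesis by simp
qed

text \<open>The code loses exactly 1 from the degree: a first exponent 1 is dropped, a larger one is
  lowered by 1. For the empty monomial the index -1 gives the same difference.\<close>

lemma deg_eq_ind_phi_tilde:
  assumes u: "u \<in> FY_tilde n"
  shows "int (deg u) = ind n (phi_tilde n u) + 1"
proof (cases "u = []")
  case True
  then show ?thesis by (simp add: phi_tilde_def deg_def ind_def)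
next
  case False
  then have len: "length u = Suc (length u - 1)" by simp
  let ?\<alpha> = "fst (phi_tilde n u)" and ?f = "snd (phi_tilde n u)"
  \<comment> \<open>\<open>1 - shift u\<close> is the letter on the nonempty first flat, so the
    exceptional index -1 is excluded.\<close>
  have "enat (1 - shift u) \<in> ?\<alpha> ` {1..n}"
    unfolding letters_phi_tilde[OF u] using len by (auto simp: shift_def)
  then have "\<not> (\<forall>i\<in>{1..n}. ?\<alpha> i = \<infinity>)" by force
  then have ind: "ind n (phi_tilde n u) = int (\<Sum>k=1..length u - shift u. ?f k)"
    unfolding ind_def case_prod_unfold max_letter_phi_tilde[OF u] by presburger
  have split1: "{1..length u} = insert 1 {2..length u}" using len by auto
  have "1 \<le> expo u 1" using u False unfolding FY_tilde_def by auto
  have "deg u = (\<Sum>k=1..length u - shift u. ?f k) + 1"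
  proof (cases "shift u = 0")
    case True
    have "(\<Sum>k=2..length u. ?f k) = (\<Sum>k=2..length u. expo u k)"
      by (intro sum.cong) (auto simp: phi_tilde_eq True)
    moreover have "?f 1 = expo u 1 - 1" using len by (simp add: phi_tilde_eq True)
    ultimately show ?thesis
      using \<open>1 \<le> expo u 1\<close> unfolding deg_def True minus_nat.diff_0 split1 by simp
  next
    case shift: False
    then have "shift u = 1" "expo u 1 = 1" by (auto simp: shift_def split: if_splits)
    have "(\<Sum>k=1..length u - 1. ?f k) = (\<Sum>k=1..length u - 1. expo u (Suc k))"
      by (intro sum.cong) (auto simp: phi_tilde_eq \<open>shift u = 1\<close>)
    also have "\<dots> = (\<Sum>k=Suc 1..Suc (length u - 1). expo u k)"
      by (rule sum.shift_bounds_cl_Suc_ivl[symmetric])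
    also have "{Suc 1..Suc (length u - 1)} = {2..length u}"
      using len by auto
    finally show ?thesis
      unfolding deg_def \<open>shift u = 1\<close> split1 using \<open>expo u 1 = 1\<close> by simp
  qed
  then show ?thesis using ind by simp
qed

section \<open>From codes to monomials\<close>

definition code_shift :: "nat \<Rightarrow> (nat \<Rightarrow> enat) \<Rightarrow> nat" where
  "code_shift n \<alpha> = (if 0 \<in> \<alpha> ` {1..n} then 1 else 0)"

text \<open>If the letter \<open>0\<close> is absent, then \<open>F\<^sub>0\<close> is still empty, so that the formula holds for \<open>j = 0\<close>.\<close>
definition code_flat :: "nat \<Rightarrow> (nat \<Rightarrow> enat) \<Rightarrow> nat \<Rightarrow> nat set" where
  "code_flat n \<alpha> j = {i\<in>{1..n}. \<alpha> i < enat (Suc j - code_shift n \<alpha>)}"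

definition code_expo :: "nat \<Rightarrow> code \<Rightarrow> nat \<Rightarrow> nat" where
  "code_expo n = (\<lambda>(\<alpha>, f) j.
     if j = 1 then (if code_shift n \<alpha> = 1 then 1 else f 1 + 1) else f (j - code_shift n \<alpha>))"

text \<open>One factor per finite letter: in a code the letters from 1 to the maximum all occur, and
  the letter 0 is counted by \<open>code_shift n \<alpha>\<close>.\<close>

definition psi_tilde :: "nat \<Rightarrow> code \<Rightarrow> monomial" where
  "psi_tilde n = (\<lambda>(\<alpha>, f).
     map (\<lambda>j. (code_flat n \<alpha> j, code_expo n (\<alpha>, f) j))
       [1..<Suc (max_letter n \<alpha> + code_shift n \<alpha>)])"

section \<open>Flats and exponents of the reconstructed monomial\<close>

lemma length_psi_tilde [simp]: "length (psi_tilde n (\<alpha>, f)) = max_letter n \<alpha> + code_shift n \<alpha>"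
  by (simp add: psi_tilde_def del: upt_Suc)

lemma code_flat_0: "code_flat n \<alpha> 0 = {}"
proof -
  have "\<alpha> i \<noteq> enat 0" if "i \<in> {1..n}" "code_shift n \<alpha> = 0" for i
    using that by (force simp: code_shift_def zero_enat_def split: if_splits)
  then have "\<not> \<alpha> i < enat (Suc 0 - code_shift n \<alpha>)" if "i \<in> {1..n}" for i
    using that by (cases "\<alpha> i") (auto simp: code_shift_def intro: gr0I)
  then show ?thesis unfolding code_flat_def by blast
qed

lemma flat_psi_tilde:
  assumes "j \<le> max_letter n \<alpha> + code_shift n \<alpha>"
  shows "flat (psi_tilde n (\<alpha>, f)) j = code_flat n \<alpha> j"
  using assms by (cases "j = 0") (auto simp: flat_def code_flat_0 psi_tilde_def simp del: upt_Suc)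

lemma expo_psi_tilde:
  assumes "j \<in> {1..max_letter n \<alpha> + code_shift n \<alpha>}"
  shows "expo (psi_tilde n (\<alpha>, f)) j = code_expo n (\<alpha>, f) j"
  using assms by (auto simp: expo_def psi_tilde_def simp del: upt_Suc)

text \<open>As \<open>code_shift n \<alpha> \<le> 1 \<le> j\<close>, the thresholds of the two flats
  are consecutive numbers, so they separate exactly one letter.\<close>

lemma code_flat_diff:
  assumes "j \<ge> 1"
  shows "code_flat n \<alpha> j - code_flat n \<alpha> (j - 1) = occ n \<alpha> (j - code_shift n \<alpha>)"
proof -
  have "code_shift n \<alpha> \<le> 1" by (simp add: code_shift_def)
  then have "x < enat (Suc j - code_shift n \<alpha>) \<and> \<not> x < enat (Suc (j - 1) - code_shift n \<alpha>)
      \<longleftrightarrow> x = enat (j - code_shift n \<alpha>)" for x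
    using assms by (cases x) auto
  then show ?thesis unfolding code_flat_def by auto
qed

lemma code_flat_mono: "j \<le> k \<Longrightarrow> code_flat n \<alpha> j \<subseteq> code_flat n \<alpha> k"
  unfolding code_flat_def by (force elim!: order.strict_trans2)

lemma card_code_flat_diff:
  assumes "j \<ge> 1"
  shows "card (code_flat n \<alpha> j) - card (code_flat n \<alpha> (j - 1)) = card (occ n \<alpha> (j - code_shift n \<alpha>))"
proof -
  have "finite (code_flat n \<alpha> (j - 1))" by (simp add: code_flat_def)
  then show ?thesis
    unfolding code_flat_diff[OF assms, symmetric]
    by (intro card_Diff_subset[symmetric] code_flat_mono) auto
qed

text \<open>If \<open>j = code_shift n \<alpha>\<close>, the shift is 1 and the letter in question
  is 0, which then occurs; otherwise the letter is positive and the bounds on \<open>f\<close> force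
  occurrences. This makes the reconstructed chain strict.\<close>

lemma occ_nonempty:
  assumes "(\<alpha>, f) \<in> ext_code n" "j \<in> {1..max_letter n \<alpha> + code_shift n \<alpha>}"
  shows "occ n \<alpha> (j - code_shift n \<alpha>) \<noteq> {}"
proof (cases "j = code_shift n \<alpha>")
  case True
  then have "0 \<in> \<alpha> ` {1..n}" using assms(2) by (auto simp: code_shift_def split: if_splits)
  then show ?thesis using True by (force simp: zero_enat_def)
next
  case False
  then have "j - code_shift n \<alpha> \<in> {1..max_letter n \<alpha>}"
    using assms(2) by (auto simp: code_shift_def split: if_splits)
  then have "0 < card (occ n \<alpha> (j - code_shift n \<alpha>))"
    using assms(1) unfolding ext_code_iff by fastforce
  then show ?thesis unfolding card_gt_0_iff by blast
qed

lemma psi_tilde_in_FY_tilde: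
  assumes c: "(\<alpha>, f) \<in> ext_code n"
  shows "psi_tilde n (\<alpha>, f) \<in> FY_tilde n"
proof -
  let ?u = "psi_tilde n (\<alpha>, f)" and ?e = "code_shift n \<alpha>"
  let ?l = "max_letter n \<alpha> + ?e"
  have "flat ?u (j - 1) \<subset> flat ?u j \<and> flat ?u j \<subseteq> {1..n}" if "j \<in> {1..?l}" for j
  proof -
    have "flat ?u (j - 1) = code_flat n \<alpha> (j - 1)" "flat ?u j = code_flat n \<alpha> j"
      using that by (auto intro!: flat_psi_tilde)
    moreover have "code_flat n \<alpha> j - code_flat n \<alpha> (j - 1) \<noteq> {}"
      using occ_nonempty[OF c that] code_flat_diff[of j n \<alpha>] that by simp
    moreover have "code_flat n \<alpha> (j - 1) \<subseteq> code_flat n \<alpha> j" by (rule code_flat_mono) simp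
    moreover have "code_flat n \<alpha> j \<subseteq> {1..n}" unfolding code_flat_def by blast
    ultimately show ?thesis by blast
  qed
  moreover have "1 \<le> expo ?u 1 \<and> expo ?u 1 \<le> card (flat ?u 1)" if "?u \<noteq> []"
  proof -
    have l: "1 \<in> {1..?l}" using that unfolding length_0_conv[symmetric] length_psi_tilde by auto
    have card: "card (flat ?u 1) = card (occ n \<alpha> (1 - ?e))"
      using card_code_flat_diff[of 1 n \<alpha>] l by (simp add: flat_psi_tilde code_flat_0)
    show ?thesis
    \<comment> \<open>The exponent 1 only requires a nonempty first flat; \<open>f 1 + 1\<close>
      fits because \<open>f 1 < card (occ n \<alpha> 1)\<close>.\<close>
    proof (cases "?e = 1")
      case True
      have "0 < card (occ n \<alpha> (1 - ?e))"
        using occ_nonempty[OF c l] unfolding card_gt_0_iff by auto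
      then show ?thesis
        unfolding card expo_psi_tilde[OF l] using True by (simp add: code_expo_def)
    next
      case False
      then have e: "?e = 0" by (simp add: code_shift_def split: if_splits)
      then have "f 1 < card (occ n \<alpha> 1)" using c l unfolding ext_code_iff by simp
      then show ?thesis
        unfolding card expo_psi_tilde[OF l] using e by (simp add: code_expo_def)
    qed
  qed
  moreover have "1 \<le> expo ?u j \<and> expo ?u j \<le> card (flat ?u j) - card (flat ?u (j - 1)) - 1"
    if j: "j \<in> {2..?l}" for j
  proof -
    have l: "j \<in> {1..?l}" using j by auto
    have "j - ?e \<in> {1..max_letter n \<alpha>}"
      using j by (auto simp: code_shift_def split: if_splits)
    then have "1 \<le> f (j - ?e) \<and> f (j - ?e) < card (occ n \<alpha> (j - ?e))"
      using c unfolding ext_code_iff by blast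
    moreover have "card (flat ?u j) - card (flat ?u (j - 1)) = card (occ n \<alpha> (j - ?e))"
    proof -
      have "flat ?u j = code_flat n \<alpha> j" "flat ?u (j - 1) = code_flat n \<alpha> (j - 1)"
        using j by (auto intro!: flat_psi_tilde)
      then show ?thesis using card_code_flat_diff[of j n \<alpha>] l by simp
    qed
    moreover have "expo ?u j = f (j - ?e)"
      unfolding expo_psi_tilde[OF l] using j by (simp add: code_expo_def)
    ultimately show ?thesis by linarith
  qed
  ultimately show ?thesis
    unfolding FY_tilde_def mem_Collect_eq length_psi_tilde by blast
qed

section \<open>The two maps are inverse to each other\<close>

text \<open>If there is a first factor and the letter 0 is absent, the first exponent is
  \<open>f 1 + 1\<close>, at least 2. So a first exponent 1 signals the letter 0
  unambiguously.\<close>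

lemma shift_psi_tilde:
  assumes c: "(\<alpha>, f) \<in> ext_code n"
  shows "shift (psi_tilde n (\<alpha>, f)) = code_shift n \<alpha>"
proof (cases "max_letter n \<alpha> + code_shift n \<alpha> = 0")
  case True
  then have "psi_tilde n (\<alpha>, f) = []" by (metis length_0_conv length_psi_tilde)
  then show ?thesis using True by (simp add: shift_def)
next
  case False
  then have l: "1 \<in> {1..max_letter n \<alpha> + code_shift n \<alpha>}" by auto
  have "psi_tilde n (\<alpha>, f) \<noteq> []"
    unfolding length_0_conv[symmetric] length_psi_tilde using False .
  moreover have "code_shift n \<alpha> = 0 \<and> f 1 \<ge> 1 \<or> code_shift n \<alpha> = 1"
  proof (cases "code_shift n \<alpha> = 0")
    case True
    then show ?thesis using c False unfolding ext_code_iff by auto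
  qed (simp add: code_shift_def split: if_splits)
  ultimately show ?thesis
    unfolding shift_def expo_psi_tilde[OF l] by (auto simp: code_expo_def)
qed

text \<open>As \<infinity> is the only value that is not finite, sequences can be compared through
  their finite letters alone.\<close>

lemma enat_eq_iff_finite: "x = y \<longleftrightarrow> (\<forall>k. x = enat k \<longleftrightarrow> y = enat k)"
  by (metis not_enat_eq)

lemma phi_psi_tilde:
  assumes c: "(\<alpha>, f) \<in> ext_code n"
  shows "phi_tilde n (psi_tilde n (\<alpha>, f)) = (\<alpha>, f)"
proof -
  let ?u = "psi_tilde n (\<alpha>, f)" and ?e = "code_shift n \<alpha>"
  let ?l = "max_letter n \<alpha> + ?e"
  note u = psi_tilde_in_FY_tilde[OF c] and e = shift_psi_tilde[OF c]
  have "fst (phi_tilde n ?u) i = enat k \<longleftrightarrow> \<alpha> i = enat k" if i: "i \<in> {1..n}" for i k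
  proof -
    \<comment> \<open>An occurrence of 0 forces \<open>?e = 1\<close>, so the index is positive even
      for \<open>k = 0\<close>.\<close>
    have "k + ?e \<in> {1..?l}" if "\<alpha> i = enat k"
    proof -
      have "0 \<in> \<alpha> ` {1..n}" if "k = 0"
        using that \<open>\<alpha> i = enat k\<close> i by (auto simp: enat_0 intro: rev_image_eqI)
      then show ?thesis
        using le_max_letter[of \<alpha> i k n] that i by (cases "k = 0") (auto simp: code_shift_def)
    qed
    moreover have "i \<in> flat ?u (k + ?e) - flat ?u (k + ?e - 1) \<longleftrightarrow> \<alpha> i = enat k"
      if "k + ?e \<in> {1..?l}"
    proof -
      have "flat ?u (k + ?e) = code_flat n \<alpha> (k + ?e)"
        "flat ?u (k + ?e - 1) = code_flat n \<alpha> (k + ?e - 1)"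
        using that by (auto intro!: flat_psi_tilde)
      then have "flat ?u (k + ?e) - flat ?u (k + ?e - 1) = occ n \<alpha> k"
        using code_flat_diff[of "k + ?e" n \<alpha>] that by simp
      then show ?thesis using i by blast
    qed
    ultimately show ?thesis
      unfolding phi_tilde_letter_iff[OF u i] e length_psi_tilde by blast
  qed
  then have "fst (phi_tilde n ?u) i = \<alpha> i" if "i \<in> {1..n}" for i
    using that enat_eq_iff_finite by blast
  moreover have "fst (phi_tilde n ?u) \<in> extensional {1..n}" by (simp add: phi_tilde_eq)
  moreover have "\<alpha> \<in> extensional {1..n}" using c by (simp add: ext_code_iff)
  ultimately have "fst (phi_tilde n ?u) = \<alpha>" by (intro extensionalityI[of _ "{1..n}"])
  moreover have "snd (phi_tilde n ?u) = f"
  proof (rule extensionalityI[of _ "{1..max_letter n \<alpha>}"])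
    fix k assume k: "k \<in> {1..max_letter n \<alpha>}"
    then have "k + ?e \<in> {1..?l}" by auto
    note x = expo_psi_tilde[OF this, of f]
    have "?e = 0 \<or> ?e = 1" by (simp add: code_shift_def)
    then show "snd (phi_tilde n ?u) k = f k"
      using k x by (auto simp: phi_tilde_eq e code_expo_def)
  qed (use c in \<open>simp_all add: phi_tilde_eq e ext_code_iff\<close>)
  ultimately show ?thesis by (simp add: prod_eq_iff)
qed

lemma psi_phi_tilde:
  assumes u: "u \<in> FY_tilde n"
  shows "psi_tilde n (phi_tilde n u) = u"
proof -
  obtain \<alpha> f where p: "phi_tilde n u = (\<alpha>, f)" by fastforce
  have m: "max_letter n \<alpha> = length u - shift u"
    using max_letter_phi_tilde[OF u] p by simp
  have "shift u \<le> length u" by (cases u) (auto simp: shift_def)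
  have "0 \<in> \<alpha> ` {1..n} \<longleftrightarrow> shift u = 1"
    using letters_phi_tilde[OF u, of 0] p \<open>shift u \<le> length u\<close>
    by (auto simp: enat_0 shift_def)
  then have e: "code_shift n \<alpha> = shift u"
    by (auto simp: code_shift_def shift_def split: if_splits)
  have len: "length (psi_tilde n (\<alpha>, f)) = length u"
    using m e \<open>shift u \<le> length u\<close> by simp
  have letter: "occ n \<alpha> (j - shift u) = flat u j - flat u (j - 1)" if "j \<in> {1..length u}" for j
  proof -
    have "j - shift u + shift u = j" using that by (auto simp: shift_def)
    then show ?thesis using occ_phi_tilde[OF u, of "j - shift u"] p that by simp
  qed
  \<comment> \<open>Both chains start at the empty set and have the same successive differences, so
    they agree by induction.\<close>
  have flat: "code_flat n \<alpha> j = flat u j" if "j \<le> length u" for j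
    using that
  proof (induction j)
    case 0
    then show ?case by (simp add: code_flat_0 flat_def)
  next
    case (Suc j)
    have "code_flat n \<alpha> (Suc j) = code_flat n \<alpha> j \<union> (code_flat n \<alpha> (Suc j) - code_flat n \<alpha> j)"
      using code_flat_mono[of j "Suc j" n \<alpha>] by auto
    also have "\<dots> = flat u j \<union> (flat u (Suc j) - flat u j)"
      using code_flat_diff[of "Suc j" n \<alpha>] letter[of "Suc j"] Suc e by simp
    also have "\<dots> = flat u (Suc j)"
      using FY_chain[OF u, of j "Suc j"] Suc.prems by auto
    finally show ?case .
  qed
  have expo: "code_expo n (\<alpha>, f) j = expo u j" if j: "j \<in> {1..length u}" for j
  proof -
    have f: "f = snd (phi_tilde n u)" using p by simp
    have "u \<noteq> []" using j by auto
    \<comment> \<open>Positivity makes \<open>expo u 1 - 1 + 1\<close> return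
      \<open>expo u 1\<close>.\<close>
    then have "1 \<le> expo u 1" using u unfolding FY_tilde_def by blast
    then show ?thesis
      using j by (auto simp: code_expo_def e f phi_tilde_eq shift_def)
  qed
  have "psi_tilde n (\<alpha>, f) ! i = u ! i" if i: "i < length u" for i
  proof -
    have "Suc i \<le> max_letter n \<alpha> + code_shift n \<alpha>" using i len by simp
    then have "flat (psi_tilde n (\<alpha>, f)) (Suc i) = flat u (Suc i)"
      "expo (psi_tilde n (\<alpha>, f)) (Suc i) = expo u (Suc i)"
      using flat[of "Suc i"] expo[of "Suc i"] i by (simp_all add: flat_psi_tilde expo_psi_tilde)
    then show ?thesis by (simp add: flat_def expo_def prod_eq_iff)
  qed
  then show ?thesis unfolding p using len by (intro nth_equalityI) auto
qed

section \<open>Equivariance\<close>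

text \<open>A permutation carries blocks to blocks of the same index and keeps the exponents, so
  \<open>shift\<close> and the second component stay the same, while the letter at \<open>i\<close>
  is the former letter at \<open>inv \<sigma> i\<close>.\<close>

lemma phi_tilde_act_monomial:
  assumes \<sigma>: "\<sigma> permutes {1..n}"
  shows "phi_tilde n (act_monomial \<sigma> u) = act_code n \<sigma> (phi_tilde n u)"
proof -
  let ?v = "act_monomial \<sigma> u"
  have len: "length ?v = length u" by (simp add: act_monomial_def)
  have flat: "flat ?v j = \<sigma> ` flat u j" if "j \<le> length u" for j
    using that by (auto simp: flat_def act_monomial_def split_beta)
  have expo: "expo ?v j = expo u j" if "j \<in> {1..length u}" for j
    using that by (auto simp: expo_def act_monomial_def split_beta)
  have mem: "i \<in> \<sigma> ` A \<longleftrightarrow> inv \<sigma> i \<in> A" for i A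
    using permutes_inverses[OF \<sigma>] by (metis image_iff)
  \<comment> \<open>The predicates under the two \<open>THE\<close> coincide, hence so do the chosen
    values.\<close>
  have block: "block ?v i = block u (inv \<sigma> i)" for i
    unfolding block_def len by (intro arg_cong[of _ _ The] ext) (auto simp: flat mem)
  have "?v = [] \<longleftrightarrow> u = []" by (simp add: act_monomial_def)
  then have shift: "shift ?v = shift u"
    using expo[of 1] by (cases "u = []") (auto simp: shift_def Suc_le_eq)
  have inv: "inv \<sigma> i \<in> {1..n} \<longleftrightarrow> i \<in> {1..n}" for i
    using permutes_in_image[OF permutes_inv[OF \<sigma>]] .
  show ?thesis
    unfolding phi_tilde_eq act_code_def prod.case len shift
  proof (intro arg_cong2[of _ _ _ _ Pair] restrict_ext)
    fix i assume "i \<in> {1..n}"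
    then have "inv \<sigma> i \<in> {1..n}" using inv by blast
    then show "(if i \<in> flat ?v (length u) then enat (block ?v i - shift u) else \<infinity>) =
      (\<lambda>i\<in>{1..n}. if i \<in> flat u (length u) then enat (block u i - shift u) else \<infinity>) (inv \<sigma> i)"
      by (simp only: restrict_apply' flat order.refl mem block)
  qed (auto simp: expo)
qed

theorem theorem4p7:
  fixes n :: nat
  assumes "n \<ge> 1"
  shows "bij_betw (phi_tilde n) (FY_tilde n) (Code_tilde n)
    \<and> (\<forall>u\<in>FY_tilde n. int (deg u) = ind n (phi_tilde n u) + 1)
    \<and> (\<forall>\<sigma> u. \<sigma> permutes {1..n} \<longrightarrow> u \<in> FY_tilde n \<longrightarrow>
         phi_tilde n (act_monomial \<sigma> u) = act_code n \<sigma> (phi_tilde n u))"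
proof (intro conjI ballI allI impI)
  show "bij_betw (phi_tilde n) (FY_tilde n) (Code_tilde n)"
    unfolding Code_tilde_eq_ext_code[OF assms]
    by (rule bij_betw_byWitness[of _ "psi_tilde n"])
      (auto simp: psi_phi_tilde phi_psi_tilde phi_tilde_in_ext_code psi_tilde_in_FY_tilde)
qed (simp_all add: deg_eq_ind_phi_tilde phi_tilde_act_monomial)

end
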